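(* Let $G$ be a topological group. Then $G$ is amenable if and only if, for every $\varepsilon > 0$, every finite subset $E \subseteq G$, and every right-invariant continuous pseudo-metric $d$ on $G$, there exists $a \in \mathbb{R}G$ with $\Vert a \Vert_{1} = 1$ and $a \geq 0$ such that $$\forall g \in E \colon \quad p_{d}(a - ga) \leq \varepsilon .$$
   Context: Let $G$ be a topological group with neutral element $e$, and let $\mathcal{U}_{e}(G)$ be the neighborhood filter of $e$. For $g \in G$ let $\lambda_{g} \colon G \to G$, $x \mapsto gx$. The right uniformity of $G$ consists of all $E \subseteq G \times G$ for which there is $U \in \mathcal{U}_{e}(G)$ such that $xy^{-1} \in U$ implies $(x,y) \in E$. $\mathrm{RUC}_{b}(G)$ is the space of bounded real-valued functions on $G$ that are uniformly continuous with respect to the right uniformity. $G$ is amenable if there is a positive linear map $\mu \colon \mathrm{RUC}_{b}(G) \to \mathbb{R}$ with $\mu(\mathbf{1}) = 1$ and $\mu(f \circ \lambda_{g}) = \mu(f)$ for all $f \in \mathrm{RUC}_{b}(G)$ and $g \in G$. $\mathbb{R}G$ is the real vector space of finitely supported functions $a \colon G \to \mathbb{R}$; $\Vert a \Vert_{1} = \sum_{x \in G} |a(x)|$; $a \geq 0$ means pointwise non-negativity; for $f \colon G \to \mathbb{R}$ put $a(f) = \sum_{x \in G} a(x) f(x)$. For $g \in G$, $ga \in \mathbb{R}G$ is given by $(ga)(x) = a(g^{-1}x)$, so that $(ga)(f) = a(f \circ \lambda_{g})$. A pseudo-metric $d$ on $G$ is right-invariant if $d(xg,yg) = d(x,y)$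 for all $g,x,y \in G$, and continuous if all its open balls $\{ y \in G \mid d(x,y) < r\}$ are open in $G$. For such $d$ and $a \in \mathbb{R}G$, $p_{d}(a) = \sup \{ |a(f)| \mid f \colon (G,d) \to [-1,1] \text{ 1-Lipschitz} \}$. *)

theory Defs
  imports "HOL-Analysis.Analysis" "HOL-Library.Poly_Mapping"
begin

text \<open>
  A topological group is a type of class \<^class>\<open>topological_group_add\<close>. That class assumes neither
  commutativity nor any separation axiom; the group is merely written additively, so that
  \<open>0\<close> is the neutral element \<open>e\<close>, \<open>g + x\<close> is the product \<open>g x\<close>, \<open>- g\<close> is the inverse of \<open>g\<close>, and
  \<open>x - y\<close> is \<open>x\<close> times the inverse of \<open>y\<close>. The order of summands matters throughout.
\<close>

definition right_uniformity :: "('a::topological_group_add \<times> 'a) filter" where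
  "right_uniformity = filtercomap (\<lambda>(x, y). x - y) (nhds 0)"

text \<open>The entourages, i.e. the sets on which the filter holds eventually, in the usual form:\<close>

lemma eventually_right_uniformity:
  fixes E :: "('a::topological_group_add \<times> 'a) set"
  shows "eventually (\<lambda>p. p \<in> E) right_uniformity \<longleftrightarrow>
    (\<exists>U. eventually (\<lambda>x. x \<in> U) (nhds 0) \<and> (\<forall>x y. x - y \<in> U \<longrightarrow> (x, y) \<in> E))"
proof
  assume "eventually (\<lambda>p. p \<in> E) right_uniformity"
  then obtain Q where "eventually Q (nhds 0)" "\<forall>p. Q (case p of (x, y) \<Rightarrow> x - y) \<longrightarrow> p \<in> E"
    unfolding right_uniformity_def eventually_filtercomap by blast
  then show "\<exists>U. eventually (\<lambda>x. x \<in> U) (nhds 0) \<and> (\<forall>x y. x - y \<in> U \<longrightarrow> (x, y) \<in> E)"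
    by (intro exI[of _ "Collect Q"]) auto
next
  assume "\<exists>U. eventually (\<lambda>x. x \<in> U) (nhds 0) \<and> (\<forall>x y. x - y \<in> U \<longrightarrow> (x, y) \<in> E)"
  then show "eventually (\<lambda>p. p \<in> E) right_uniformity"
    unfolding right_uniformity_def eventually_filtercomap by fastforce
qed

definition RUC\<^sub>b :: "('a::topological_group_add \<Rightarrow> real) set" where
  "RUC\<^sub>b = {f. bounded (range f) \<and>
    filterlim (\<lambda>(x, y). (f x, f y)) uniformity right_uniformity}"

text \<open>
  The functional \<open>\<mu>\<close> is a total function on all of \<^typ>\<open>'a \<Rightarrow> real\<close>, but only its values on
  \<open>RUC\<^sub>b\<close> are constrained.
\<close>

definition is_invariant_mean :: "(('a::topological_group_add \<Rightarrow> real) \<Rightarrow> real) \<Rightarrow> bool" where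
  "is_invariant_mean \<mu> \<longleftrightarrow>
    (\<forall>f\<in>RUC\<^sub>b. \<forall>h\<in>RUC\<^sub>b. \<mu> (\<lambda>x. f x + h x) = \<mu> f + \<mu> h) \<and>
    (\<forall>c. \<forall>f\<in>RUC\<^sub>b. \<mu> (\<lambda>x. c * f x) = c * \<mu> f) \<and>
    (\<forall>f\<in>RUC\<^sub>b. (\<forall>x. 0 \<le> f x) \<longrightarrow> 0 \<le> \<mu> f) \<and>
    \<mu> (\<lambda>x. 1) = 1 \<and>
    (\<forall>f\<in>RUC\<^sub>b. \<forall>g. \<mu> (f \<circ> (\<lambda>x. g + x)) = \<mu> f)"

definition amenable_group :: "'a::topological_group_add itself \<Rightarrow> bool" where
  "amenable_group _ \<longleftrightarrow> (\<exists>\<mu> :: ('a \<Rightarrow> real) \<Rightarrow> real. is_invariant_mean \<mu>)"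

text \<open>
  The space of finitely supported real functions on the group is \<^typ>\<open>'a \<Rightarrow>\<^sub>0 real\<close>. The order
  that the library puts on this type is lexicographic, hence the separate predicate below for
  pointwise non-negativity.
\<close>

definition nonneg_pointwise :: "('a \<Rightarrow>\<^sub>0 real) \<Rightarrow> bool" where
  "nonneg_pointwise a \<longleftrightarrow> (\<forall>x. 0 \<le> Poly_Mapping.lookup a x)"

definition l1_norm :: "('a \<Rightarrow>\<^sub>0 real) \<Rightarrow> real" where
  "l1_norm a = (\<Sum>x\<in>Poly_Mapping.keys a. \<bar>Poly_Mapping.lookup a x\<bar>)"

definition pairing :: "('a \<Rightarrow>\<^sub>0 real) \<Rightarrow> ('a \<Rightarrow> real) \<Rightarrow> real" where
  "pairing a f = (\<Sum>x\<in>Poly_Mapping.keys a. Poly_Mapping.lookup a x * f x)"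

definition translate :: "'a::group_add \<Rightarrow> ('a \<Rightarrow>\<^sub>0 real) \<Rightarrow> ('a \<Rightarrow>\<^sub>0 real)" where
  "translate g a = Poly_Mapping.map_key (\<lambda>x. - g + x) a"

lemma lookup_translate:
  "Poly_Mapping.lookup (translate g a) x = Poly_Mapping.lookup a (- g + x)"
  by (simp add: translate_def map_key.rep_eq inj_def)

lemma pairing_translate: "pairing (translate g a) f = pairing a (f \<circ> (\<lambda>x. g + x))"
  unfolding pairing_def
  by (rule sum.reindex_bij_witness[of _ "\<lambda>x. g + x" "\<lambda>x. - g + x"])
     (auto simp: in_keys_iff lookup_translate add.assoc[symmetric])

definition is_pseudo_metric :: "('a \<Rightarrow> 'a \<Rightarrow> real) \<Rightarrow> bool" where
  "is_pseudo_metric d \<longleftrightarrow>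
    (\<forall>x y. 0 \<le> d x y) \<and> (\<forall>x. d x x = 0) \<and> (\<forall>x y. d x y = d y x) \<and>
    (\<forall>x y z. d x z \<le> d x y + d y z)"

definition right_invariant :: "('a::group_add \<Rightarrow> 'a \<Rightarrow> real) \<Rightarrow> bool" where
  "right_invariant d \<longleftrightarrow> (\<forall>g x y. d (x + g) (y + g) = d x y)"

definition continuous_pseudo_metric :: "('a::topological_space \<Rightarrow> 'a \<Rightarrow> real) \<Rightarrow> bool" where
  "continuous_pseudo_metric d \<longleftrightarrow> (\<forall>x r. open {y. d x y < r})"

definition Lip1 :: "('a \<Rightarrow> 'a \<Rightarrow> real) \<Rightarrow> ('a \<Rightarrow> real) set" where
  "Lip1 d = {f. (\<forall>x. f x \<in> {-1..1}) \<and> (\<forall>x y. \<bar>f x - f y\<bar> \<le> d x y)}"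

text \<open>
  The supremum is taken over a set which is bounded (by the \<open>\<ell>\<^sup>1\<close>-norm) and, for a
  pseudo-metric \<open>d\<close>, nonempty, so it is a genuine supremum of reals.
\<close>

definition lip_seminorm :: "('a \<Rightarrow> 'a \<Rightarrow> real) \<Rightarrow> ('a \<Rightarrow>\<^sub>0 real) \<Rightarrow> real" where
  "lip_seminorm d a = (SUP f\<in>Lip1 d. \<bar>pairing a f\<bar>)"

end

theory Submission
  imports Defs
begin

text \<open>
  If \<open>\<mu>\<close> is an invariant mean, then each \<open>F = (\<Sum>g\<in>E. h\<^sub>g - h\<^sub>g \<circ> \<lambda>\<^sub>g)\<close> with all \<open>h\<^sub>g\<close> in \<^term>\<open>Lip1 d\<close>
  has \<open>\<mu> F = 0\<close> and hence takes a value below \<open>\<epsilon>\<close>. These functions form a convex set that is compact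
  for pointwise convergence, so a minimax argument gives one probability vector \<open>a\<close> with
  \<open>a F \<le> \<epsilon>\<close> for all of them at once; this replaces the Hahn-Banach theorem. Conversely, finitely many
  functions in \<^term>\<open>RUC\<^sub>b\<close> with values in \<open>[-1, 1]\<close> are 1-Lipschitz for a common continuous
  right-invariant pseudo-metric, namely the sum of the \<open>SUP z. \<bar>f (x + z) - f (y + z)\<bar>\<close>.
  Hence finitely many approximate invariance conditions can be met simultaneously, and
  the Tychonoff theorem yields a mean that meets all of them.
\<close>

section \<open>Products of compact sets and a minimax principle\<close>

text \<open>Tychonoff's theorem for the product topology on function types. It serves at three
  levels: functions with values in an interval, families of Lipschitz functions, and functionals on
  functions.\<close>

lemma compact_Collect_coordinatewise:
  fixes S :: "'i \<Rightarrow> 'b::topological_space set"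
  assumes "\<And>i. compact (S i)"
  shows "compact {f. \<forall>i. f i \<in> S i}"
proof -
  have "compactin (product_topology (\<lambda>i. euclidean) UNIV) (PiE UNIV S)"
    using assms by (subst compactin_PiE) auto
  then have "compact (PiE UNIV S)"
    by (simp add: euclidean_product_topology)
  moreover have "PiE UNIV S = {f. \<forall>i. f i \<in> S i}"
    by (auto simp: PiE_def)
  ultimately show ?thesis by simp
qed

text \<open>
  The weights are the positive parts of \<open>\<epsilon> - F\<^sub>0\<close>, where \<open>F\<^sub>0 \<in> K\<close> has minimal squared Euclidean
  distance from the orthant of vectors that are at least \<open>\<epsilon>\<close> on \<open>A\<close>; the claim is the first-order
  condition at \<open>F\<^sub>0\<close>.
\<close>

lemma finite_minimax:
  fixes K :: "('x \<Rightarrow> real) set" and \<epsilon> :: real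
  assumes "compact K" and "K \<noteq> {}"
    and convex: "\<And>F H t. F \<in> K \<Longrightarrow> H \<in> K \<Longrightarrow> 0 \<le> t \<Longrightarrow> t \<le> 1 \<Longrightarrow> (\<lambda>x. (1 - t) * F x + t * H x) \<in> K"
    and "finite A" and below: "\<And>F. F \<in> K \<Longrightarrow> \<exists>x\<in>A. F x < \<epsilon>"
  shows "\<exists>w. (\<forall>x. 0 \<le> w x) \<and> sum w A = 1 \<and> (\<forall>F\<in>K. (\<Sum>x\<in>A. w x * F x) \<le> \<epsilon>)"
proof -
  define \<phi> where "\<phi> F = (\<Sum>x\<in>A. (max 0 (\<epsilon> - F x))\<^sup>2)" for F :: "'x \<Rightarrow> real"
  have "continuous_on K \<phi>"
    unfolding \<phi>_def by (intro continuous_intros continuous_on_subset[OF continuous_on_product_coordinates]) auto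
  then obtain F\<^sub>0 where F\<^sub>0: "F\<^sub>0 \<in> K" and min: "\<And>F. F \<in> K \<Longrightarrow> \<phi> F\<^sub>0 \<le> \<phi> F"
    using continuous_attains_inf[OF \<open>compact K\<close> \<open>K \<noteq> {}\<close>] by blast
  define v where "v x = max 0 (\<epsilon> - F\<^sub>0 x)" for x
  have v_nonneg: "0 \<le> v x" for x by (simp add: v_def)
  \<comment> \<open>A point of \<open>A\<close> below \<epsilon> makes the total weight positive, so
    that \<open>v\<close> can be normalised at the end.\<close>
  obtain x\<^sub>0 where x\<^sub>0: "x\<^sub>0 \<in> A" "F\<^sub>0 x\<^sub>0 < \<epsilon>" using below[OF F\<^sub>0] by blast
  then have "0 < v x\<^sub>0" by (simp add: v_def)
  then have v_pos: "0 < sum v A"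
    using x\<^sub>0 \<open>finite A\<close> v_nonneg by (intro sum_pos2[of _ x\<^sub>0]) auto
  have first_order: "(\<Sum>x\<in>A. v x * (F x - F\<^sub>0 x)) \<le> 0" if "F \<in> K" for F
  proof -
    define p where "p = (\<Sum>x\<in>A. v x * (F x - F\<^sub>0 x))"
    define q where "q = (\<Sum>x\<in>A. (F x - F\<^sub>0 x)\<^sup>2)"
    have "q \<ge> 0" by (simp add: q_def sum_nonneg)
    have le: "2 * p \<le> t * q" if t: "0 < t" "t \<le> 1" for t
    proof -
      have "\<phi> F\<^sub>0 \<le> \<phi> (\<lambda>x. (1 - t) * F\<^sub>0 x + t * F x)"
        using t \<open>F \<in> K\<close> F\<^sub>0 by (intro min convex) auto
      also have "\<dots> \<le> (\<Sum>x\<in>A. (v x - t * (F x - F\<^sub>0 x))\<^sup>2)"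
        unfolding \<phi>_def
      proof (intro sum_mono)
        fix x
        \<comment> \<open>The argument of the positive part is
          \<open>(\<epsilon> - F\<^sub>0 x) - t * (F x - F\<^sub>0 x)\<close>, and
          \<open>v x\<close> dominates its first term.\<close>
        have "max 0 (\<epsilon> - ((1 - t) * F\<^sub>0 x + t * F x)) \<le> \<bar>v x - t * (F x - F\<^sub>0 x)\<bar>"
          unfolding v_def by (auto simp: algebra_simps max_def abs_if)
        then show "(max 0 (\<epsilon> - ((1 - t) * F\<^sub>0 x + t * F x)))\<^sup>2 \<le> (v x - t * (F x - F\<^sub>0 x))\<^sup>2"
          by (metis abs_le_square_iff abs_of_nonneg max.cobounded1)
      qed
      also have "\<dots> = (\<Sum>x\<in>A. (v x)\<^sup>2 - 2 * t * (v x * (F x - F\<^sub>0 x)) + t\<^sup>2 * (F x - F\<^sub>0 x)\<^sup>2)"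
        by (intro sum.cong) (auto simp: power2_eq_square algebra_simps)
      also have "\<dots> = \<phi> F\<^sub>0 - 2 * t * p + t\<^sup>2 * q"
        by (simp only: \<phi>_def p_def q_def v_def sum.distrib sum_subtractf sum_distrib_left)
      finally have "t * (2 * p) \<le> t * (t * q)"
        by (simp add: power2_eq_square mult_ac)
      with t show ?thesis by simp
    qed
    \<comment> \<open>Dividing by \<open>t\<close> has left only the second-order term
      \<open>t * q\<close>, which vanishes as \<open>t\<close> decreases to 0.\<close>
    have "((\<lambda>t. t * q) \<longlongrightarrow> 0 * q) (at_right 0)"
      by (intro tendsto_intros)
    moreover have "\<forall>\<^sub>F t in at_right 0. 2 * p \<le> t * q"
      using eventually_at_right_real[of 0 1] by (rule eventually_mono) (auto intro: le)
    ultimately have "2 * p \<le> 0 * q"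
      by (intro tendsto_lowerbound[where F = "at_right 0"]) auto
    then show ?thesis by (simp add: p_def)
  qed
  show ?thesis
  proof (intro exI[of _ "\<lambda>x. v x / sum v A"] conjI allI ballI)
    show "(\<Sum>x\<in>A. v x / sum v A) = 1"
      using v_pos by (simp flip: sum_divide_distrib)
    fix F assume F: "F \<in> K"
    have "(\<Sum>x\<in>A. v x * F x) \<le> (\<Sum>x\<in>A. v x * F\<^sub>0 x)"
      using first_order[OF F] by (simp add: right_diff_distrib sum_subtractf)
    \<comment> \<open>The weight \<open>v x\<close> is 0 wherever \<open>F\<^sub>0 x\<close> is at
      least \<epsilon>, so only points below \<epsilon> contribute.\<close>
    also have "\<dots> \<le> (\<Sum>x\<in>A. v x * \<epsilon>)"
      by (intro sum_mono) (auto simp: v_def max_def intro!: mult_left_mono)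
    finally show "(\<Sum>x\<in>A. v x / sum v A * F x) \<le> \<epsilon>"
      using v_pos by (simp add: pos_divide_le_eq mult.commute[of \<epsilon>] flip: sum_divide_distrib sum_distrib_right)
  qed (use v_pos v_nonneg in auto)
qed

text \<open>For each point \<open>x\<close>, the functions below \<epsilon> at \<open>x\<close> form
  an open set, and these sets cover \<open>K\<close>. Compactness leaves finitely many points, to
  which the finite case applies.\<close>

lemma minimax:
  fixes K :: "('x \<Rightarrow> real) set" and \<epsilon> :: real
  assumes "compact K" and "K \<noteq> {}"
    and "\<And>F H t. F \<in> K \<Longrightarrow> H \<in> K \<Longrightarrow> 0 \<le> t \<Longrightarrow> t \<le> 1 \<Longrightarrow> (\<lambda>x. (1 - t) * F x + t * H x) \<in> K"
    and below: "\<And>F. F \<in> K \<Longrightarrow> \<exists>x. F x < \<epsilon>"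
  shows "\<exists>A w. finite A \<and> (\<forall>x. 0 \<le> w x) \<and> sum w A = 1 \<and> (\<forall>F\<in>K. (\<Sum>x\<in>A. w x * F x) \<le> \<epsilon>)"
proof -
  have "open {F :: 'x \<Rightarrow> real. F x < \<epsilon>}" for x
    by (intro open_Collect_less continuous_intros) auto
  moreover have "K \<subseteq> (\<Union>x\<in>UNIV. {F. F x < \<epsilon>})"
    using below by auto
  ultimately obtain A where "finite A" and A: "K \<subseteq> (\<Union>x\<in>A. {F. F x < \<epsilon>})"
    by (rule compactE_image[OF \<open>compact K\<close>, of UNIV "\<lambda>x. {F. F x < \<epsilon>}"])
  have "\<exists>x\<in>A. F x < \<epsilon>" if "F \<in> K" for F
    using A that by blast
  then show ?thesis
    using finite_minimax[OF assms(1-3) \<open>finite A\<close>] \<open>finite A\<close> by blast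
qed

section \<open>Finitely supported functions and their pairing\<close>

text \<open>The supports of \<open>a\<close>, \<open>b\<close> and \<open>a - b\<close> differ;
  summing over one common finite set makes the pairings comparable.\<close>

lemma pairing_superset:
  assumes "finite S" "Poly_Mapping.keys a \<subseteq> S"
  shows "pairing a f = (\<Sum>x\<in>S. Poly_Mapping.lookup a x * f x)"
  unfolding pairing_def using assms by (intro sum.mono_neutral_left) (auto simp: in_keys_iff)

lemma pairing_diff: "pairing (a - b) f = pairing a f - pairing b f"
proof -
  let ?S = "Poly_Mapping.keys a \<union> Poly_Mapping.keys b"
  have "pairing (a - b) f = (\<Sum>x\<in>?S. Poly_Mapping.lookup (a - b) x * f x)"
    by (intro pairing_superset) (auto dest!: keys_diff[THEN subsetD])
  then show ?thesis
    by (simp add: pairing_superset[of ?S a] pairing_superset[of ?S b] lookup_minus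
        left_diff_distrib sum_subtractf)
qed

lemma pairing_add_right: "pairing a (\<lambda>x. f x + h x) = pairing a f + pairing a h"
  by (simp add: pairing_def distrib_left sum.distrib)

lemma pairing_diff_right: "pairing a (\<lambda>x. f x - h x) = pairing a f - pairing a h"
  by (simp add: pairing_def right_diff_distrib sum_subtractf)

lemma pairing_cmult_right: "pairing a (\<lambda>x. c * f x) = c * pairing a f"
  by (simp add: pairing_def sum_distrib_left mult_ac)

lemma pairing_nonneg: "nonneg_pointwise a \<Longrightarrow> (\<And>x. 0 \<le> f x) \<Longrightarrow> 0 \<le> pairing a f"
  by (auto simp: pairing_def nonneg_pointwise_def intro!: sum_nonneg)

lemma pairing_one: "nonneg_pointwise a \<Longrightarrow> pairing a (\<lambda>x. 1) = l1_norm a"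
  by (simp add: pairing_def l1_norm_def nonneg_pointwise_def)

lemma abs_pairing_le:
  assumes "\<And>x. \<bar>f x\<bar> \<le> B"
  shows "\<bar>pairing a f\<bar> \<le> B * l1_norm a"
proof -
  have "\<bar>pairing a f\<bar> \<le> (\<Sum>x\<in>Poly_Mapping.keys a. \<bar>Poly_Mapping.lookup a x * f x\<bar>)"
    unfolding pairing_def by (rule sum_abs)
  also have "\<dots> \<le> (\<Sum>x\<in>Poly_Mapping.keys a. B * \<bar>Poly_Mapping.lookup a x\<bar>)"
    using assms by (intro sum_mono) (simp add: abs_mult mult.commute mult_right_mono)
  finally show ?thesis by (simp add: l1_norm_def sum_distrib_left)
qed

text \<open>This converts the output of \<open>minimax\<close> into an element of the group ring:
  the values of \<open>w\<close> outside \<open>A\<close> are cut off to 0.\<close>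

lemma finitely_supported_weights:
  fixes w :: "'a \<Rightarrow> real"
  assumes "finite A" "\<And>x. 0 \<le> w x"
  shows "\<exists>a. nonneg_pointwise a \<and> l1_norm a = sum w A \<and> (\<forall>f. pairing a f = (\<Sum>x\<in>A. w x * f x))"
proof -
  define a where "a = (\<Sum>x\<in>A. Poly_Mapping.single x (w x))"
  have lookup: "Poly_Mapping.lookup a x = (if x \<in> A then w x else 0)" for x
    using \<open>finite A\<close> by (simp add: a_def lookup_sum lookup_single when_def)
  then have "Poly_Mapping.keys a \<subseteq> A"
    by (auto simp: in_keys_iff split: if_splits)
  then have pairing: "pairing a f = (\<Sum>x\<in>A. w x * f x)" for f
    using \<open>finite A\<close> by (subst pairing_superset) (auto simp: lookup)
  have "nonneg_pointwise a"
    using assms by (simp add: nonneg_pointwise_def lookup)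
  moreover from this have "l1_norm a = sum w A"
    by (subst pairing_one[symmetric]) (auto simp: pairing)
  ultimately show ?thesis using pairing by blast
qed

section \<open>The Lipschitz seminorm and the convex compact set \<open>Lip1\<close>\<close>

lemma lip_seminorm_upper:
  assumes "f \<in> Lip1 d"
  shows "\<bar>pairing a f\<bar> \<le> lip_seminorm d a"
  unfolding lip_seminorm_def
proof (rule cSUP_upper[OF assms])
  have "\<bar>pairing a h\<bar> \<le> 1 * l1_norm a" if "h \<in> Lip1 d" for h
    using that by (intro abs_pairing_le) (auto simp: Lip1_def abs_le_iff minus_le_iff)
  then show "bdd_above ((\<lambda>f. \<bar>pairing a f\<bar>) ` Lip1 d)"
    by (meson bdd_aboveI2)
qed

lemma zero_in_Lip1: "is_pseudo_metric d \<Longrightarrow> (\<lambda>x. 0) \<in> Lip1 d"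
  by (simp add: Lip1_def is_pseudo_metric_def)

lemma uminus_in_Lip1: "f \<in> Lip1 d \<Longrightarrow> (\<lambda>x. - f x) \<in> Lip1 d"
  by (fastforce simp: Lip1_def abs_minus_commute minus_le_iff)

text \<open>Both conditions in \<open>Lip1\<close> bound the absolute value of a quantity linear in
  the function, so one estimate for convex combinations of reals settles both.\<close>

lemma convex_Lip1:
  assumes "f \<in> Lip1 d" "h \<in> Lip1 d" "0 \<le> t" "t \<le> 1"
  shows "(\<lambda>x. (1 - t) * f x + t * h x) \<in> Lip1 d"
proof -
  have "\<bar>(1 - t) * r + t * s\<bar> \<le> c" if "\<bar>r\<bar> \<le> c" "\<bar>s\<bar> \<le> c" for r s c :: real
  proof -
    have "\<bar>(1 - t) * r + t * s\<bar> \<le> (1 - t) * \<bar>r\<bar> + t * \<bar>s\<bar>"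
      using assms(3,4) abs_triangle_ineq[of "(1 - t) * r" "t * s"] by (simp add: abs_mult)
    also have "\<dots> \<le> c"
      using that assms(3,4) by (intro convex_bound_le) auto
    finally show ?thesis .
  qed
  note bound = this
  have "\<bar>(1 - t) * f x + t * h x\<bar> \<le> 1" for x
    using assms(1,2) by (intro bound) (auto simp: Lip1_def abs_le_iff minus_le_iff)
  moreover have "\<bar>(1 - t) * f x + t * h x - ((1 - t) * f y + t * h y)\<bar> \<le> d x y" for x y
    using bound[of "f x - f y" "d x y" "h x - h y"] assms(1,2)
    by (simp add: Lip1_def algebra_simps)
  ultimately show ?thesis
    by (simp add: Lip1_def abs_le_iff) (smt (verit))
qed

text \<open>The Lipschitz condition is an intersection of closed conditions on two coordinates each,
  inside a product of compact intervals.\<close>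

lemma compact_Lip1: "compact (Lip1 d)"
proof -
  have "compact {f :: 'a \<Rightarrow> real. \<forall>x. f x \<in> {-1..1}}"
    by (intro compact_Collect_coordinatewise) simp
  moreover have "closed {f :: 'a \<Rightarrow> real. \<forall>x y. \<bar>f x - f y\<bar> \<le> d x y}"
    by (intro closed_Collect_all closed_Collect_le continuous_intros) auto
  ultimately have "compact ({f. \<forall>x. f x \<in> {-1..1}} \<inter> {f. \<forall>x y. \<bar>f x - f y\<bar> \<le> d x y})"
    by (rule compact_Int_closed)
  then show ?thesis by (simp add: Lip1_def Collect_conj_eq)
qed

section \<open>Bounded right uniformly continuous functions\<close>

text \<open>Substituting \<open>z = x - y\<close>, that is \<open>x = z + y\<close>, turns
  entourages into neighbourhoods of 0. All closure properties are derived from this epsilon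
  form.\<close>

lemma RUC\<^sub>b_iff:
  "f \<in> RUC\<^sub>b \<longleftrightarrow> bounded (range f) \<and> (\<forall>e>0. \<forall>\<^sub>F z in nhds 0. \<forall>x. \<bar>f (z + x) - f x\<bar> < e)"
proof -
  have "filterlim (\<lambda>(x, y). (f x, f y)) uniformity right_uniformity \<longleftrightarrow>
      (\<forall>e>0. \<forall>\<^sub>F z in nhds 0. \<forall>x. \<bar>f (z + x) - f x\<bar> < e)"
  proof (intro iffI allI impI)
    fix e :: real
    assume lim: "filterlim (\<lambda>(x, y). (f x, f y)) uniformity right_uniformity" and "0 < e"
    have "\<forall>\<^sub>F p in uniformity. \<bar>fst p - snd p\<bar> < e"
      using \<open>0 < e\<close> unfolding eventually_uniformity_metric dist_real_def by auto
    then have "\<forall>\<^sub>F p in right_uniformity. \<bar>f (fst p) - f (snd p)\<bar> < e"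
      using lim by (auto simp: filterlim_iff case_prod_unfold)
    then obtain Q where "eventually Q (nhds 0)"
      and Q: "\<And>p. Q (case p of (x, y) \<Rightarrow> x - y) \<Longrightarrow> \<bar>f (fst p) - f (snd p)\<bar> < e"
      unfolding right_uniformity_def eventually_filtercomap by blast
    from this(1) show "\<forall>\<^sub>F z in nhds 0. \<forall>x. \<bar>f (z + x) - f x\<bar> < e"
    proof (rule eventually_mono, intro allI)
      fix z x assume "Q z"
      then show "\<bar>f (z + x) - f x\<bar> < e"
        using Q[of "(z + x, x)"] by simp
    qed
  next
    assume *: "\<forall>e>0. \<forall>\<^sub>F z in nhds 0. \<forall>x. \<bar>f (z + x) - f x\<bar> < e"
    show "filterlim (\<lambda>(x, y). (f x, f y)) uniformity right_uniformity"
      unfolding filterlim_iff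
    proof (intro allI impI)
      fix P :: "real \<times> real \<Rightarrow> bool" assume "eventually P uniformity"
      then obtain e where "e > 0" and P: "\<And>u v. \<bar>u - v\<bar> < e \<Longrightarrow> P (u, v)"
        unfolding eventually_uniformity_metric dist_real_def by blast
      have "P (f x, f y)" if "\<forall>u. \<bar>f (x - y + u) - f u\<bar> < e" for x y
        using P that[rule_format, of y] by simp
      moreover have "\<forall>\<^sub>F z in nhds 0. \<forall>u. \<bar>f (z + u) - f u\<bar> < e"
        using * \<open>e > 0\<close> by blast
      ultimately show "\<forall>\<^sub>F p in right_uniformity. P (case p of (x, y) \<Rightarrow> (f x, f y))"
        unfolding right_uniformity_def eventually_filtercomap
        by (intro exI[of _ "\<lambda>z. \<forall>u. \<bar>f (z + u) - f u\<bar> < e"]) auto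
    qed
  qed
  then show ?thesis by (simp add: RUC\<^sub>b_def)
qed

lemma RUC\<^sub>b_bounded: "f \<in> RUC\<^sub>b \<Longrightarrow> bounded (range f)"
  by (simp add: RUC\<^sub>b_iff)

lemma RUC\<^sub>b_const: "(\<lambda>x. c) \<in> RUC\<^sub>b"
  by (simp add: RUC\<^sub>b_iff)

lemma RUC\<^sub>b_add:
  assumes f: "f \<in> RUC\<^sub>b" and h: "h \<in> RUC\<^sub>b"
  shows "(\<lambda>x. f x + h x) \<in> RUC\<^sub>b"
  unfolding RUC\<^sub>b_iff
proof (intro conjI allI impI)
  show "bounded (range (\<lambda>x. f x + h x))"
    by (intro bounded_plus_comp RUC\<^sub>b_bounded assms)
  fix e :: real assume "0 < e"
  then have "0 < e / 2" by simp
  then have "\<forall>\<^sub>F z in nhds 0. \<forall>x. \<bar>f (z + x) - f x\<bar> < e / 2"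
    "\<forall>\<^sub>F z in nhds 0. \<forall>x. \<bar>h (z + x) - h x\<bar> < e / 2"
    using f h unfolding RUC\<^sub>b_iff by blast+
  then show "\<forall>\<^sub>F z in nhds 0. \<forall>x. \<bar>f (z + x) + h (z + x) - (f x + h x)\<bar> < e"
  proof eventually_elim
    case (elim z)
    show ?case
    proof
      fix x
      show "\<bar>f (z + x) + h (z + x) - (f x + h x)\<bar> < e"
        using elim(1)[rule_format, of x] elim(2)[rule_format, of x] by linarith
    qed
  qed
qed

lemma RUC\<^sub>b_cmult:
  assumes f: "f \<in> RUC\<^sub>b"
  shows "(\<lambda>x. c * f x) \<in> RUC\<^sub>b"
  unfolding RUC\<^sub>b_iff
proof (intro conjI allI impI)
  show "bounded (range (\<lambda>x. c * f x))"
    using bounded_scaling[OF RUC\<^sub>b_bounded[OF f], of c] by (simp add: image_image)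
  fix e :: real assume "0 < e"
  \<comment> \<open>Adding 1 keeps the divisor positive when \<open>c\<close> is 0.\<close>
  then have "\<forall>\<^sub>F z in nhds 0. \<forall>x. \<bar>f (z + x) - f x\<bar> < e / (\<bar>c\<bar> + 1)"
    using f by (auto simp: RUC\<^sub>b_iff)
  then show "\<forall>\<^sub>F z in nhds 0. \<forall>x. \<bar>c * f (z + x) - c * f x\<bar> < e"
  proof (rule eventually_mono, intro allI)
    fix z x assume "\<forall>x. \<bar>f (z + x) - f x\<bar> < e / (\<bar>c\<bar> + 1)"
    then have "(\<bar>c\<bar> + 1) * \<bar>f (z + x) - f x\<bar> < e"
      by (simp add: pos_less_divide_eq mult.commute)
    moreover have "\<bar>c * f (z + x) - c * f x\<bar> = \<bar>c\<bar> * \<bar>f (z + x) - f x\<bar>"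
      by (simp add: abs_mult flip: right_diff_distrib)
    ultimately show "\<bar>c * f (z + x) - c * f x\<bar> < e"
      by (simp add: algebra_simps)
  qed
qed

lemma RUC\<^sub>b_diff: "f \<in> RUC\<^sub>b \<Longrightarrow> h \<in> RUC\<^sub>b \<Longrightarrow> (\<lambda>x. f x - h x) \<in> RUC\<^sub>b"
  using RUC\<^sub>b_add[OF _ RUC\<^sub>b_cmult[of h "-1"], of f] by simp

text \<open>Since \<open>g + (z + x) = (g + z - g) + (g + x)\<close>, a perturbation by
  \<open>z\<close> before the translation is a perturbation by a conjugate of \<open>z\<close> after
  it, and conjugation is continuous and fixes 0.\<close>

lemma RUC\<^sub>b_translate:
  assumes f: "f \<in> RUC\<^sub>b"
  shows "f \<circ> (\<lambda>x. g + x) \<in> RUC\<^sub>b"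
  unfolding RUC\<^sub>b_iff
proof (intro conjI allI impI)
  show "bounded (range (f \<circ> (\<lambda>x. g + x)))"
    using RUC\<^sub>b_bounded[OF f] by (rule bounded_subset) auto
  fix e :: real assume "0 < e"
  then have "\<forall>\<^sub>F z in nhds 0. \<forall>x. \<bar>f (z + x) - f x\<bar> < e"
    using f by (auto simp: RUC\<^sub>b_iff)
  moreover have "filterlim (\<lambda>z. g + z - g) (nhds 0) (nhds 0)"
  proof -
    have "((\<lambda>z. g + z - g) \<longlongrightarrow> g + 0 - g) (nhds 0)"
      by (intro tendsto_intros filterlim_ident)
    then show ?thesis by simp
  qed
  ultimately have "\<forall>\<^sub>F z in nhds 0. \<forall>x. \<bar>f (g + z - g + x) - f x\<bar> < e"
    unfolding filterlim_iff by blast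
  then show "\<forall>\<^sub>F z in nhds 0. \<forall>x. \<bar>(f \<circ> (\<lambda>x. g + x)) (z + x) - (f \<circ> (\<lambda>x. g + x)) x\<bar> < e"
  proof (rule eventually_mono, intro allI)
    fix z x assume "\<forall>x. \<bar>f (g + z - g + x) - f x\<bar> < e"
    moreover have "g + z - g + (g + x) = g + (z + x)"
      by (metis add.assoc diff_add_cancel)
    ultimately show "\<bar>(f \<circ> (\<lambda>x. g + x)) (z + x) - (f \<circ> (\<lambda>x. g + x)) x\<bar> < e"
      by (metis comp_apply)
  qed
qed

section \<open>Continuity of right-invariant pseudo-metrics\<close>

text \<open>Right invariance gives \<open>d z y = d (z - y) 0\<close>, so the behaviour near any
  \<open>y\<close> is controlled near 0; the triangle inequality then makes all balls open.\<close>

lemma continuous_right_invariant_pseudo_metric_iff: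
  fixes d :: "'a::topological_group_add \<Rightarrow> 'a \<Rightarrow> real"
  assumes d: "is_pseudo_metric d" and inv: "right_invariant d"
  shows "continuous_pseudo_metric d \<longleftrightarrow> (\<forall>e>0. \<forall>\<^sub>F z in nhds 0. d z 0 < e)"
proof (intro iffI allI impI)
  fix e :: real
  assume cont: "continuous_pseudo_metric d" and "0 < e"
  have "open {z. d 0 z < e}"
    using cont by (simp add: continuous_pseudo_metric_def)
  moreover have "0 \<in> {z. d 0 z < e}"
    using d \<open>0 < e\<close> by (simp add: is_pseudo_metric_def)
  ultimately have "\<forall>\<^sub>F z in nhds 0. z \<in> {z. d 0 z < e}"
    by (rule eventually_nhds_in_open)
  moreover have "d 0 z = d z 0" for z
    using d unfolding is_pseudo_metric_def by blast
  ultimately show "\<forall>\<^sub>F z in nhds 0. d z 0 < e"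
    by simp
next
  assume small: "\<forall>e>0. \<forall>\<^sub>F z in nhds 0. d z 0 < e"
  show "continuous_pseudo_metric d"
    unfolding continuous_pseudo_metric_def
  proof (intro allI)
    fix x r
    show "open {y. d x y < r}"
    proof (subst open_subopen, intro ballI)
      fix y assume y: "y \<in> {y. d x y < r}"
      have "((\<lambda>z. z - y) \<longlongrightarrow> y - y) (nhds y)"
        by (intro tendsto_intros filterlim_ident)
      then have "filterlim (\<lambda>z. z - y) (nhds 0) (nhds y)"
        by simp
      moreover have "\<forall>\<^sub>F z in nhds 0. d z 0 < r - d x y"
        using small y by simp
      ultimately have "\<forall>\<^sub>F z in nhds y. d (z - y) 0 < r - d x y"
        by (rule eventually_compose_filterlim[rotated])
      then have "\<forall>\<^sub>F z in nhds y. d x z < r"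
      proof eventually_elim
        case (elim z)
        have "d (z - y) 0 = d z y"
          using inv[unfolded right_invariant_def, rule_format, of "z - y" y 0] by simp
        then show "d x z < r"
          using elim d unfolding is_pseudo_metric_def by (smt (verit))
      qed
      then show "\<exists>T. open T \<and> y \<in> T \<and> T \<subseteq> {y. d x y < r}"
        unfolding eventually_nhds by blast
    qed
  qed
qed

text \<open>The bound \<open>d (z + x) x = d z 0\<close> is independent of \<open>x\<close>, which
  supplies the uniformity.\<close>

lemma Lip1_subset_RUC\<^sub>b:
  fixes d :: "'a::topological_group_add \<Rightarrow> 'a \<Rightarrow> real"
  assumes "is_pseudo_metric d" "right_invariant d" "continuous_pseudo_metric d"
  shows "Lip1 d \<subseteq> RUC\<^sub>b"
proof
  fix f assume f: "f \<in> Lip1 d"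
  show "f \<in> RUC\<^sub>b"
    unfolding RUC\<^sub>b_iff
  proof (intro conjI allI impI)
    show "bounded (range f)"
      using f by (intro bounded_subset[OF bounded_closed_interval[of "-1" 1]]) (auto simp: Lip1_def)
    fix e :: real assume "0 < e"
    then have "\<forall>\<^sub>F z in nhds 0. d z 0 < e"
      using continuous_right_invariant_pseudo_metric_iff assms by blast
    then show "\<forall>\<^sub>F z in nhds 0. \<forall>x. \<bar>f (z + x) - f x\<bar> < e"
    proof (rule eventually_mono, intro allI)
      fix z x assume "d z 0 < e"
      moreover have "d (z + x) (0 + x) = d z 0"
        using assms(2) unfolding right_invariant_def by blast
      moreover have "\<bar>f (z + x) - f x\<bar> \<le> d (z + x) x"
        using f by (simp add: Lip1_def)
      ultimately show "\<bar>f (z + x) - f x\<bar> < e" by simp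
    qed
  qed
qed

section \<open>Means and coboundaries\<close>

text \<open>Invariance is split off because the final compactness argument treats it separately:
  pairing with one vector is exactly a mean but only approximately invariant.\<close>

definition is_mean :: "(('a::topological_group_add \<Rightarrow> real) \<Rightarrow> real) \<Rightarrow> bool" where
  "is_mean \<mu> \<longleftrightarrow>
    (\<forall>f\<in>RUC\<^sub>b. \<forall>h\<in>RUC\<^sub>b. \<mu> (\<lambda>x. f x + h x) = \<mu> f + \<mu> h) \<and>
    (\<forall>c. \<forall>f\<in>RUC\<^sub>b. \<mu> (\<lambda>x. c * f x) = c * \<mu> f) \<and>
    (\<forall>f\<in>RUC\<^sub>b. (\<forall>x. 0 \<le> f x) \<longrightarrow> 0 \<le> \<mu> f) \<and>
    \<mu> (\<lambda>x. 1) = 1"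

lemma is_invariant_mean_iff:
  "is_invariant_mean \<mu> \<longleftrightarrow> is_mean \<mu> \<and> (\<forall>f\<in>RUC\<^sub>b. \<forall>g. \<mu> (f \<circ> (\<lambda>x. g + x)) = \<mu> f)"
  unfolding is_invariant_mean_def is_mean_def by blast

lemma mean_add: "is_mean \<mu> \<Longrightarrow> f \<in> RUC\<^sub>b \<Longrightarrow> h \<in> RUC\<^sub>b \<Longrightarrow> \<mu> (\<lambda>x. f x + h x) = \<mu> f + \<mu> h"
  by (simp add: is_mean_def)

lemma mean_cmult: "is_mean \<mu> \<Longrightarrow> f \<in> RUC\<^sub>b \<Longrightarrow> \<mu> (\<lambda>x. c * f x) = c * \<mu> f"
  by (simp add: is_mean_def)

lemma mean_diff: "is_mean \<mu> \<Longrightarrow> f \<in> RUC\<^sub>b \<Longrightarrow> h \<in> RUC\<^sub>b \<Longrightarrow> \<mu> (\<lambda>x. f x - h x) = \<mu> f - \<mu> h"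
  using mean_add[of \<mu> f "\<lambda>x. - 1 * h x"] mean_cmult[of \<mu> h "- 1"] RUC\<^sub>b_cmult[of h "- 1"] by simp

lemma mean_nonneg: "is_mean \<mu> \<Longrightarrow> f \<in> RUC\<^sub>b \<Longrightarrow> (\<And>x. 0 \<le> f x) \<Longrightarrow> 0 \<le> \<mu> f"
  by (simp add: is_mean_def)

lemma mean_const: "is_mean \<mu> \<Longrightarrow> \<mu> (\<lambda>x. c) = c"
  using mean_cmult[of \<mu> "\<lambda>x. 1" c] RUC\<^sub>b_const[of 1] by (simp add: is_mean_def)

text \<open>Membership and vanishing are proved in one induction, since \<mu> is additive only on
  \<open>RUC\<^sub>b\<close>.\<close>

lemma invariant_mean_coboundary:
  assumes \<mu>: "is_invariant_mean \<mu>" and "finite E" and h: "\<And>g. h g \<in> RUC\<^sub>b"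
  shows "(\<lambda>x. \<Sum>g\<in>E. h g x - h g (g + x)) \<in> RUC\<^sub>b \<and> \<mu> (\<lambda>x. \<Sum>g\<in>E. h g x - h g (g + x)) = 0"
  using \<open>finite E\<close>
proof induction
  case empty
  show ?case using \<mu> by (simp add: RUC\<^sub>b_const mean_const is_invariant_mean_iff)
next
  case (insert g E)
  have mean: "is_mean \<mu>" and inv: "\<mu> (h g \<circ> (\<lambda>x. g + x)) = \<mu> (h g)"
    using \<mu> h by (auto simp: is_invariant_mean_iff)
  have t: "(\<lambda>x. h g (g + x)) \<in> RUC\<^sub>b"
    using RUC\<^sub>b_translate[OF h, of g g] by (simp add: comp_def)
  then have "(\<lambda>x. h g x - h g (g + x)) \<in> RUC\<^sub>b" and "\<mu> (\<lambda>x. h g x - h g (g + x)) = 0"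
    using mean_diff[OF mean h t] inv by (auto simp: comp_def intro: RUC\<^sub>b_diff h)
  then show ?case
    using insert by (simp add: RUC\<^sub>b_add mean_add[OF mean])
qed

lemma mean_less_imp_less:
  assumes \<mu>: "is_mean \<mu>" and F: "F \<in> RUC\<^sub>b" and "\<mu> F < c"
  shows "\<exists>x. F x < c"
proof (rule ccontr)
  assume "\<not> ?thesis"
  then have "0 \<le> \<mu> (\<lambda>x. F x - c)"
    by (intro mean_nonneg[OF \<mu> RUC\<^sub>b_diff[OF F RUC\<^sub>b_const[of c]]]) (simp add: not_less)
  also have "\<dots> = \<mu> F - c"
    using mean_diff[OF \<mu> F RUC\<^sub>b_const[of c]] mean_const[OF \<mu>] by simp
  finally show False
    using \<open>\<mu> F < c\<close> by simp
qed

section \<open>From an invariant mean to almost invariant vectors\<close>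

lemma amenable_imp_almost_invariant:
  fixes d :: "'a::topological_group_add \<Rightarrow> 'a \<Rightarrow> real" and \<mu> :: "('a \<Rightarrow> real) \<Rightarrow> real"
  assumes \<mu>: "is_invariant_mean \<mu>" and "0 < \<epsilon>" and "finite E"
    and d: "is_pseudo_metric d" "right_invariant d" "continuous_pseudo_metric d"
  obtains a where "l1_norm a = 1" "nonneg_pointwise a"
    "\<And>g. g \<in> E \<Longrightarrow> lip_seminorm d (a - translate g a) \<le> \<epsilon>"
proof -
  define \<Phi> where "\<Phi> h x = (\<Sum>g\<in>E. h g x - h g (g + x))" for h :: "'a \<Rightarrow> 'a \<Rightarrow> real" and x
  \<comment> \<open>Indexing the families by the whole group makes \<open>L\<close> a full product
    of copies of \<open>Lip1 d\<close>.\<close>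
  define L where "L = {h. \<forall>g :: 'a. h g \<in> Lip1 d}"
  have "compact L"
    unfolding L_def by (intro compact_Collect_coordinatewise compact_Lip1)
  moreover have coord: "continuous_on L (\<lambda>h. h g x)" for g x
    by (rule continuous_on_product_then_coordinatewise)
       (intro continuous_on_subset[OF continuous_on_product_coordinates] subset_UNIV)
  have "continuous_on L \<Phi>"
    unfolding \<Phi>_def by (intro continuous_intros coord)
  ultimately have "compact (\<Phi> ` L)"
    by (rule compact_continuous_image[rotated])
  moreover have "\<Phi> ` L \<noteq> {}"
    using zero_in_Lip1[OF d(1)] by (auto simp: L_def)
  \<comment> \<open>\<Phi> is linear and \<open>L\<close> is convex, so the image is convex.\<close>
  moreover have "(\<lambda>x. (1 - t) * F x + t * H x) \<in> \<Phi> ` L"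
    if FH: "F \<in> \<Phi> ` L" "H \<in> \<Phi> ` L" and t: "0 \<le> t" "t \<le> 1" for F H t
  proof -
    obtain f h where fh: "f \<in> L" "F = \<Phi> f" "h \<in> L" "H = \<Phi> h"
      using FH by blast
    have "(\<lambda>g x. (1 - t) * f g x + t * h g x) \<in> L"
      using fh t by (auto simp: L_def intro!: convex_Lip1)
    moreover have "(\<lambda>x. (1 - t) * F x + t * H x) = \<Phi> (\<lambda>g x. (1 - t) * f g x + t * h g x)"
      unfolding fh \<Phi>_def sum_distrib_left sum.distrib[symmetric]
      by (intro ext sum.cong) (auto simp: algebra_simps)
    ultimately show ?thesis by blast
  qed
  moreover have "\<exists>x. F x < \<epsilon>" if F: "F \<in> \<Phi> ` L" for F
  proof -
    obtain h where h: "\<And>g. h g \<in> Lip1 d" "F = \<Phi> h"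
      using F by (auto simp: L_def)
    then have "F \<in> RUC\<^sub>b" "\<mu> F = 0"
      using invariant_mean_coboundary[OF \<mu> \<open>finite E\<close>, of h] Lip1_subset_RUC\<^sub>b[OF d]
      by (auto simp: \<Phi>_def[abs_def] subset_iff)
    then show ?thesis
      using \<open>0 < \<epsilon>\<close> \<mu> by (intro mean_less_imp_less[of \<mu>]) (auto simp: is_invariant_mean_iff)
  qed
  ultimately have "\<exists>A w. finite A \<and> (\<forall>x. 0 \<le> w x) \<and> sum w A = 1 \<and>
      (\<forall>F\<in>\<Phi> ` L. (\<Sum>x\<in>A. w x * F x) \<le> \<epsilon>)"
    by (rule minimax)
  then obtain A w where A: "finite A" "\<And>x. 0 \<le> w x" "sum w A = 1"
    "\<And>F. F \<in> \<Phi> ` L \<Longrightarrow> (\<Sum>x\<in>A. w x * F x) \<le> \<epsilon>"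
    by blast
  obtain a where a: "nonneg_pointwise a" "l1_norm a = sum w A"
    and pair: "\<And>f. pairing a f = (\<Sum>x\<in>A. w x * f x)"
    using finitely_supported_weights[of A w] A(1,2) by blast
  have le: "pairing (a - translate g a) f \<le> \<epsilon>" if "g \<in> E" "f \<in> Lip1 d" for g f
  proof -
    \<comment> \<open>This family isolates the summand of \<open>g\<close>, so that the bound on
      sums over \<open>E\<close> gives one for each \<open>g\<close> alone.\<close>
    define h where "h k = (if k = g then f else (\<lambda>x. 0))" for k
    have "h \<in> L"
      using that zero_in_Lip1[OF d(1)] by (simp add: L_def h_def)
    have "\<Phi> h x = (\<Sum>k\<in>E. if k = g then f x - f (g + x) else 0)" for x
      unfolding \<Phi>_def h_def by (intro sum.cong) auto
    then have "\<Phi> h = (\<lambda>x. f x - f (g + x))"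
      using \<open>g \<in> E\<close> \<open>finite E\<close> by auto
    then have "pairing a (\<lambda>x. f x - f (g + x)) \<le> \<epsilon>"
      using A(4)[OF imageI[OF \<open>h \<in> L\<close>]] pair by simp
    then show ?thesis
      by (simp add: pairing_diff pairing_translate pairing_diff_right comp_def)
  qed
  \<comment> \<open>\<open>Lip1 d\<close> is closed under negation, which upgrades the one-sided
    bound to absolute values.\<close>
  have "lip_seminorm d (a - translate g a) \<le> \<epsilon>" if "g \<in> E" for g
    unfolding lip_seminorm_def
  proof (rule cSUP_least)
    show "Lip1 d \<noteq> {}" using zero_in_Lip1[OF d(1)] by blast
    fix f assume "f \<in> Lip1 d"
    then show "\<bar>pairing (a - translate g a) f\<bar> \<le> \<epsilon>"
      using le[OF \<open>g \<in> E\<close>, of f] le[OF \<open>g \<in> E\<close> uminus_in_Lip1, of f]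
        pairing_cmult_right[of "a - translate g a" "- 1" f] by simp
  qed
  with a A(3) show thesis by (intro that[of a]) auto
qed

section \<open>Pseudo-metrics induced by functions\<close>

text \<open>For bounded \<open>f\<close> this is the supremum distance between the left translates
  of \<open>f\<close> by \<open>x\<close> and \<open>y\<close>, pulled back along the orbit
  map.\<close>

definition orbit_pseudo_metric :: "('a::group_add \<Rightarrow> real) \<Rightarrow> 'a \<Rightarrow> 'a \<Rightarrow> real" where
  "orbit_pseudo_metric f x y = (SUP z. \<bar>f (x + z) - f (y + z)\<bar>)"

lemma bdd_above_orbit:
  fixes f :: "'a::group_add \<Rightarrow> real"
  assumes "bounded (range f)"
  shows "bdd_above (range (\<lambda>z. \<bar>f (x + z) - f (y + z)\<bar>))"
proof -
  obtain B where B: "\<And>x. \<bar>f x\<bar> \<le> B"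
    using assms by (auto simp: bounded_iff)
  show ?thesis
  proof (rule bdd_aboveI2)
    fix z
    show "\<bar>f (x + z) - f (y + z)\<bar> \<le> 2 * B"
      using B[of "x + z"] B[of "y + z"] by linarith
  qed
qed

lemma orbit_pseudo_metric_upper:
  "bounded (range f) \<Longrightarrow> \<bar>f (x + z) - f (y + z)\<bar> \<le> orbit_pseudo_metric f x y"
  unfolding orbit_pseudo_metric_def by (intro cSUP_upper bdd_above_orbit) auto

lemma orbit_pseudo_metric_least:
  "(\<And>z. \<bar>f (x + z) - f (y + z)\<bar> \<le> c) \<Longrightarrow> orbit_pseudo_metric f x y \<le> c"
  unfolding orbit_pseudo_metric_def by (rule cSUP_least) auto

lemma orbit_pseudo_metric:
  assumes f: "bounded (range f)"
  shows "is_pseudo_metric (orbit_pseudo_metric f)"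
  unfolding is_pseudo_metric_def
proof (intro conjI allI)
  fix x y z
  show "0 \<le> orbit_pseudo_metric f x y"
    using orbit_pseudo_metric_upper[OF f, of x 0 y] by linarith
  show "orbit_pseudo_metric f x x = 0"
    by (simp add: orbit_pseudo_metric_def)
  show "orbit_pseudo_metric f x y = orbit_pseudo_metric f y x"
    by (simp add: orbit_pseudo_metric_def abs_minus_commute)
  show "orbit_pseudo_metric f x z \<le> orbit_pseudo_metric f x y + orbit_pseudo_metric f y z"
  proof (rule orbit_pseudo_metric_least)
    fix u
    show "\<bar>f (x + u) - f (z + u)\<bar> \<le> orbit_pseudo_metric f x y + orbit_pseudo_metric f y z"
      using orbit_pseudo_metric_upper[OF f, of x u y] orbit_pseudo_metric_upper[OF f, of y u z]
      by linarith
  qed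
qed

text \<open>Shifting both points by \<open>g\<close> only reindexes the supremum along the bijection
  that sends \<open>z\<close> to \<open>g + z\<close>.\<close>

lemma right_invariant_orbit: "right_invariant (orbit_pseudo_metric f)"
  unfolding right_invariant_def
proof (intro allI)
  fix g x y
  have "range (\<lambda>z. \<bar>f (x + g + z) - f (y + g + z)\<bar>) =
      (\<lambda>z. \<bar>f (x + z) - f (y + z)\<bar>) ` range (\<lambda>z. g + z)"
    unfolding image_image by (simp only: add.assoc)
  also have "range (\<lambda>z. g + z) = UNIV"
    by (rule surj_plus)
  finally show "orbit_pseudo_metric f (x + g) (y + g) = orbit_pseudo_metric f x y"
    by (simp add: orbit_pseudo_metric_def)
qed

lemma orbit_pseudo_metric_small:
  assumes f: "f \<in> RUC\<^sub>b" and "0 < e"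
  shows "\<forall>\<^sub>F z in nhds 0. orbit_pseudo_metric f z 0 < e"
proof -
  have "\<forall>\<^sub>F z in nhds 0. \<forall>x. \<bar>f (z + x) - f x\<bar> < e / 2"
    \<comment> \<open>Half of \<open>e\<close> is used because passing to the supremum weakens the
      strict bound.\<close>
    using f half_gt_zero[OF \<open>0 < e\<close>] unfolding RUC\<^sub>b_iff by blast
  then show ?thesis
  proof (rule eventually_mono)
    fix z assume "\<forall>x. \<bar>f (z + x) - f x\<bar> < e / 2"
    then have "orbit_pseudo_metric f z 0 \<le> e / 2"
      by (intro orbit_pseudo_metric_least) (simp add: less_imp_le)
    with \<open>0 < e\<close> show "orbit_pseudo_metric f z 0 < e" by simp
  qed
qed

lemma common_pseudo_metric:
  fixes T :: "('a::topological_group_add \<Rightarrow> real) set"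
  assumes "finite T" and T: "T \<subseteq> RUC\<^sub>b" and T1: "\<And>f x. f \<in> T \<Longrightarrow> f x \<in> {-1..1}"
  obtains d where "is_pseudo_metric d" "right_invariant d" "continuous_pseudo_metric d" "T \<subseteq> Lip1 d"
proof -
  define d where "d x y = (\<Sum>f\<in>T. orbit_pseudo_metric f x y)" for x y
  have pm: "is_pseudo_metric (orbit_pseudo_metric f)" if "f \<in> T" for f
    using that T by (intro orbit_pseudo_metric RUC\<^sub>b_bounded) auto
  have "is_pseudo_metric d"
    using pm unfolding d_def is_pseudo_metric_def sum.distrib[symmetric]
    by (auto intro!: sum_nonneg sum.neutral sum.cong sum_mono)
  moreover have "right_invariant d"
    using right_invariant_orbit by (auto simp: d_def right_invariant_def intro!: sum.cong)
  moreover have "\<forall>\<^sub>F z in nhds 0. d z 0 < e" if "0 < e" for e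
  proof -
    \<comment> \<open>The added 1 covers empty \<open>T\<close> and makes the total strictly smaller
      than \<open>e\<close>.\<close>
    have "\<forall>\<^sub>F z in nhds 0. \<forall>f\<in>T. orbit_pseudo_metric f z 0 < e / (card T + 1)"
      using T \<open>0 < e\<close> \<open>finite T\<close>
      by (intro eventually_ball_finite ballI orbit_pseudo_metric_small) auto
    then show ?thesis
    proof (rule eventually_mono)
      fix z assume "\<forall>f\<in>T. orbit_pseudo_metric f z 0 < e / (card T + 1)"
      then have "d z 0 \<le> (\<Sum>f\<in>T. e / (card T + 1))"
        unfolding d_def by (intro sum_mono) (simp add: less_imp_le)
      also have "\<dots> < e"
        using \<open>0 < e\<close> by (simp add: field_simps)
      finally show "d z 0 < e" .
    qed
  qed
  ultimately have "continuous_pseudo_metric d"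
    using continuous_right_invariant_pseudo_metric_iff by blast
  moreover have "T \<subseteq> Lip1 d"
  proof
    fix f assume f: "f \<in> T"
    have "\<bar>f x - f y\<bar> \<le> d x y" for x y
    proof -
      have "\<bar>f x - f y\<bar> \<le> orbit_pseudo_metric f x y"
        using orbit_pseudo_metric_upper[of f x 0 y] f T RUC\<^sub>b_bounded by auto
      also have "\<dots> \<le> d x y"
        unfolding d_def using f pm \<open>finite T\<close>
        by (intro member_le_sum) (auto simp: is_pseudo_metric_def)
      finally show ?thesis .
    qed
    then show "f \<in> Lip1 d"
      using T1[OF f] by (simp add: Lip1_def)
  qed
  ultimately show thesis
    using that \<open>is_pseudo_metric d\<close> \<open>right_invariant d\<close> by blast
qed

section \<open>From almost invariant vectors to an invariant mean\<close>

text \<open>Each clause compares finitely many coordinates of \<mu>, hence is closed for pointwise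
  convergence.\<close>

lemma closed_means: "closed {\<mu>. is_mean \<mu>}"
  unfolding is_mean_def Ball_def
  by (intro closed_Collect_conj closed_Collect_all closed_Collect_imp open_Collect_const
      closed_Collect_eq closed_Collect_le continuous_intros) auto

lemma almost_invariant_imp_amenable:
  assumes approx: "\<And>\<epsilon> E d. 0 < \<epsilon> \<Longrightarrow> finite E \<Longrightarrow> is_pseudo_metric d \<Longrightarrow> right_invariant d \<Longrightarrow>
      continuous_pseudo_metric d \<Longrightarrow> \<exists>a :: 'a::topological_group_add \<Rightarrow>\<^sub>0 real.
        l1_norm a = 1 \<and> nonneg_pointwise a \<and> (\<forall>g\<in>E. lip_seminorm d (a - translate g a) \<le> \<epsilon>)"
  shows "\<exists>\<mu> :: ('a \<Rightarrow> real) \<Rightarrow> real. is_invariant_mean \<mu>"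
proof -
  \<comment> \<open>Functionals are total, so the compact box needs an interval for every function;
    for unbounded \<open>f\<close> it need only contain 0.\<close>
  have "\<forall>f :: 'a \<Rightarrow> real. \<exists>b\<ge>0. bounded (range f) \<longrightarrow> (\<forall>x. \<bar>f x\<bar> \<le> b)"
  proof
    fix f :: "'a \<Rightarrow> real"
    show "\<exists>b\<ge>0. bounded (range f) \<longrightarrow> (\<forall>x. \<bar>f x\<bar> \<le> b)"
    proof (cases "bounded (range f)")
      case True
      then show ?thesis
        unfolding bounded_pos by (auto intro: less_imp_le)
    qed auto
  qed
  then obtain B where B: "\<And>f :: 'a \<Rightarrow> real. 0 \<le> B f"
    "\<And>f :: 'a \<Rightarrow> real. \<And>x. bounded (range f) \<Longrightarrow> \<bar>f x\<bar> \<le> B f"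
    by metis
  define S where "S = {\<mu> :: ('a \<Rightarrow> real) \<Rightarrow> real. \<forall>f. \<mu> f \<in> {- B f..B f}} \<inter> {\<mu>. is_mean \<mu>}"
  \<comment> \<open>Each index carries its own tolerance \<open>e\<close>, since a single vector
    meets only approximate conditions. Values in \<open>{-1..1}\<close> match \<open>Lip1\<close>;
    rescaling reaches the other functions later.\<close>
  define I where "I = {(f :: 'a \<Rightarrow> real, g :: 'a, e :: real). f \<in> RUC\<^sub>b \<and> (\<forall>x. f x \<in> {-1..1}) \<and> 0 < e}"
  define C where "C = (\<lambda>(f, g, e). {\<mu> :: ('a \<Rightarrow> real) \<Rightarrow> real. \<bar>\<mu> (f \<circ> (\<lambda>x. g + x)) - \<mu> f\<bar> \<le> e})"
  have "S \<inter> (\<Inter>i\<in>I. C i) \<noteq> {}"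
  proof (rule compact_imp_fip_image)
    show "compact S"
      unfolding S_def
      by (intro compact_Int_closed compact_Collect_coordinatewise closed_means) simp
    show "closed (C i)" for i
      unfolding C_def case_prod_unfold by (intro closed_Collect_le continuous_intros) auto
    fix J assume J: "finite J" "J \<subseteq> I"
    obtain d where d: "is_pseudo_metric d" "right_invariant d" "continuous_pseudo_metric d"
      "fst ` J \<subseteq> Lip1 d"
      using J by (elim common_pseudo_metric[of "fst ` J", rotated 3]) (auto simp: I_def)
    \<comment> \<open>The strictest tolerance in \<open>J\<close>; the inserted 1 covers the case of
      empty \<open>J\<close>.\<close>
    define e where "e = Min (insert 1 ((snd \<circ> snd) ` J))"
    have "0 < e"
      using J by (auto simp: e_def I_def)
    then obtain a where a: "l1_norm a = 1" "nonneg_pointwise a"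
      and inv: "\<And>g. g \<in> (fst \<circ> snd) ` J \<Longrightarrow> lip_seminorm d (a - translate g a) \<le> e"
      using approx[of e "(fst \<circ> snd) ` J" d] J d by blast
    \<comment> \<open>The value 0 on unbounded functions keeps \<nu> inside the box.\<close>
    define \<nu> where "\<nu> f = (if bounded (range f) then pairing a f else 0)" for f
    have \<nu>: "\<nu> f = pairing a f" if "f \<in> RUC\<^sub>b" for f
      using RUC\<^sub>b_bounded[OF that] by (simp add: \<nu>_def)
    have "\<bar>\<nu> f\<bar> \<le> B f" for f
      using abs_pairing_le[of f "B f" a] B[of f] a by (simp add: \<nu>_def)
    then have "\<nu> f \<in> {- B f..B f}" for f
      by (simp add: abs_le_iff minus_le_iff)
    moreover have "is_mean \<nu>"
      using a unfolding is_mean_def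
      by (auto simp: \<nu> RUC\<^sub>b_add RUC\<^sub>b_cmult RUC\<^sub>b_const pairing_add_right pairing_cmult_right
          pairing_one intro: pairing_nonneg)
    moreover have "\<nu> \<in> C i" if i: "i \<in> J" for i
    proof -
      obtain f g r where fgr: "i = (f, g, r)" by (cases i)
      then have f: "f \<in> Lip1 d" "f \<in> RUC\<^sub>b"
        using i d(4) J by (auto simp: I_def image_subset_iff)
      have "\<bar>\<nu> (f \<circ> (\<lambda>x. g + x)) - \<nu> f\<bar> = \<bar>pairing (a - translate g a) f\<bar>"
        using f by (simp add: \<nu> RUC\<^sub>b_translate pairing_diff pairing_translate abs_minus_commute)
      also have "\<dots> \<le> lip_seminorm d (a - translate g a)"
        using f by (intro lip_seminorm_upper)
      also have "\<dots> \<le> e"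
        using i fgr by (intro inv) force
      also have "\<dots> \<le> r"
        using i fgr J unfolding e_def by (intro Min_le) force+
      finally show ?thesis by (simp add: C_def fgr)
    qed
    ultimately have "\<nu> \<in> S \<inter> (\<Inter>i\<in>J. C i)"
      unfolding S_def by blast
    then show "S \<inter> (\<Inter>i\<in>J. C i) \<noteq> {}" by blast
  qed
  then obtain \<mu> where "\<mu> \<in> S" and in_C: "\<And>i. i \<in> I \<Longrightarrow> \<mu> \<in> C i"
    by blast
  then have \<mu>: "is_mean \<mu>" by (simp add: S_def)
  have C: "\<bar>\<mu> (f \<circ> (\<lambda>x. g + x)) - \<mu> f\<bar> \<le> e"
    if "f \<in> RUC\<^sub>b" "\<And>x. f x \<in> {-1..1}" "0 < e" for f g e
    using in_C[of "(f, g, e)"] that by (simp add: I_def C_def)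
  have "\<mu> (f \<circ> (\<lambda>x. g + x)) = \<mu> f" if f: "f \<in> RUC\<^sub>b" for f g
  proof -
    \<comment> \<open>This factor scales \<open>f\<close> into \<open>{-1..1}\<close>; the summand 1
      prevents division by zero.\<close>
    define c where "c = 1 / (1 + B f)"
    have c: "0 < c"
      using B(1)[of f] by (simp add: c_def)
    have "c * f x \<in> {-1..1}" for x
    proof -
      have "\<bar>f x\<bar> \<le> 1 + B f"
        using B(2)[OF RUC\<^sub>b_bounded[OF f], of x] by simp
      then have "\<bar>c * f x\<bar> \<le> 1"
        using B(1)[of f] by (simp add: c_def abs_mult)
      then show ?thesis by (simp add: abs_le_iff minus_le_iff)
    qed
    then have "\<bar>\<mu> ((\<lambda>x. c * f x) \<circ> (\<lambda>x. g + x)) - \<mu> (\<lambda>x. c * f x)\<bar> \<le> 0 + e" if "0 < e" for e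
      using C[OF RUC\<^sub>b_cmult[OF f, of c] _ that, of g] by simp
    then have "\<bar>\<mu> ((\<lambda>x. c * f x) \<circ> (\<lambda>x. g + x)) - \<mu> (\<lambda>x. c * f x)\<bar> \<le> 0"
      by (rule field_le_epsilon)
    moreover have "\<mu> ((\<lambda>x. c * f x) \<circ> (\<lambda>x. g + x)) = c * \<mu> (f \<circ> (\<lambda>x. g + x))"
      using mean_cmult[OF \<mu> RUC\<^sub>b_translate[OF f, of g], of c] by (simp add: comp_def)
    moreover have "\<mu> (\<lambda>x. c * f x) = c * \<mu> f"
      by (rule mean_cmult[OF \<mu> f])
    ultimately show ?thesis using c by simp
  qed
  then have "is_invariant_mean \<mu>"
    using \<mu> by (simp add: is_invariant_mean_iff)
  then show ?thesis by blast
qed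

theorem theorem3p2:
  shows "amenable_group TYPE('a::topological_group_add) \<longleftrightarrow>
    (\<forall>\<epsilon>>0. \<forall>E::'a set. finite E \<longrightarrow>
      (\<forall>d. is_pseudo_metric d \<and> right_invariant d \<and> continuous_pseudo_metric d \<longrightarrow>
        (\<exists>a :: 'a \<Rightarrow>\<^sub>0 real. l1_norm a = 1 \<and> nonneg_pointwise a \<and>
          (\<forall>g\<in>E. lip_seminorm d (a - translate g a) \<le> \<epsilon>))))"
  (is "_ \<longleftrightarrow> ?approx")
proof
  assume "amenable_group TYPE('a)"
  then obtain \<mu> :: "('a \<Rightarrow> real) \<Rightarrow> real" where \<mu>: "is_invariant_mean \<mu>"
    by (auto simp: amenable_group_def)
  show ?approx
  proof (intro allI impI, elim conjE)
    fix \<epsilon> :: real and E :: "'a set" and d :: "'a \<Rightarrow> 'a \<Rightarrow> real"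
    assume "0 < \<epsilon>" "finite E" "is_pseudo_metric d" "right_invariant d" "continuous_pseudo_metric d"
    from amenable_imp_almost_invariant[OF \<mu> this]
    show "\<exists>a. l1_norm a = 1 \<and> nonneg_pointwise a \<and>
        (\<forall>g\<in>E. lip_seminorm d (a - translate g a) \<le> \<epsilon>)"
      by metis
  qed
next
  assume ?approx
  then have "\<exists>\<mu> :: ('a \<Rightarrow> real) \<Rightarrow> real. is_invariant_mean \<mu>"
    by (intro almost_invariant_imp_amenable) blast
  then show "amenable_group TYPE('a)"
    by (simp add: amenable_group_def)
qed

end
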